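(* Let $R$ and $S$ be rings and let ${}_RM_S$ be an $(R,S)$-bimodule. An element $\left(\begin{array}{cc} a & m\\ 0 & b\end{array}\right)$ of the formal triangular matrix ring $T=\left(\begin{array}{cc} R & M\\ 0 & S\end{array}\right)$ is regular in $T$ if and only if there exist idempotents $e\in R$ and $f\in S$ such that $aR=eR$, $Sb=Sf$ and $(1-e)m(1-f)=0$.
   Context: Rings are associative with identity and modules are unital. An element $a$ of a ring $R$ is (von Neumann) regular if $a=aba$ for some $b\in R$. The formal triangular matrix ring consists of matrices with $a\in R$, $m\in M$, $b\in S$, with the usual matrix addition and multiplication. *)

theory Defs
  imports "HOL-Algebra.Algebra"
begin

text \<open>A bimodule extends the record of left modules by a right scalar multiplication.
  As for \<^locale>\<open>module\<close>, the \<open>mult\<close> and \<open>one\<close> fields inherited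
  from \<^typ>\<open>'m ring\<close> are irrelevant. The locale \<^locale>\<open>module\<close> itself is not
  reused because it requires a commutative ring of scalars.\<close>

record ('r, 's, 'm) bimodule = "('r, 'm) module" +
  rsmult :: "['m, 's] \<Rightarrow> 'm" (infixl \<open>\<odot>\<^sub>r\<index>\<close> 70)

locale bimodule = R?: ring R + S?: ring S + M?: abelian_group M
  for R :: "('r, 'x) ring_scheme" (structure)
    and S :: "('s, 'y) ring_scheme" (structure)
    and M :: "('r, 's, 'm, 'z) bimodule_scheme" (structure) +
  assumes lsmult_closed [simp, intro]:
      "\<lbrakk>r \<in> carrier R; x \<in> carrier M\<rbrakk> \<Longrightarrow> r \<odot>\<^bsub>M\<^esub> x \<in> carrier M"
    and lsmult_l_distr:
      "\<lbrakk>r \<in> carrier R; r' \<in> carrier R; x \<in> carrier M\<rbrakk> \<Longrightarrow>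
       (r \<oplus>\<^bsub>R\<^esub> r') \<odot>\<^bsub>M\<^esub> x = r \<odot>\<^bsub>M\<^esub> x \<oplus>\<^bsub>M\<^esub> r' \<odot>\<^bsub>M\<^esub> x"
    and lsmult_r_distr:
      "\<lbrakk>r \<in> carrier R; x \<in> carrier M; y \<in> carrier M\<rbrakk> \<Longrightarrow>
       r \<odot>\<^bsub>M\<^esub> (x \<oplus>\<^bsub>M\<^esub> y) = r \<odot>\<^bsub>M\<^esub> x \<oplus>\<^bsub>M\<^esub> r \<odot>\<^bsub>M\<^esub> y"
    and lsmult_assoc:
      "\<lbrakk>r \<in> carrier R; r' \<in> carrier R; x \<in> carrier M\<rbrakk> \<Longrightarrow>
       (r \<otimes>\<^bsub>R\<^esub> r') \<odot>\<^bsub>M\<^esub> x = r \<odot>\<^bsub>M\<^esub> (r' \<odot>\<^bsub>M\<^esub> x)"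
    and lsmult_one [simp]:
      "x \<in> carrier M \<Longrightarrow> \<one>\<^bsub>R\<^esub> \<odot>\<^bsub>M\<^esub> x = x"
    and rsmult_closed [simp, intro]:
      "\<lbrakk>x \<in> carrier M; s \<in> carrier S\<rbrakk> \<Longrightarrow> x \<odot>\<^sub>r\<^bsub>M\<^esub> s \<in> carrier M"
    and rsmult_l_distr:
      "\<lbrakk>x \<in> carrier M; y \<in> carrier M; s \<in> carrier S\<rbrakk> \<Longrightarrow>
       (x \<oplus>\<^bsub>M\<^esub> y) \<odot>\<^sub>r\<^bsub>M\<^esub> s = x \<odot>\<^sub>r\<^bsub>M\<^esub> s \<oplus>\<^bsub>M\<^esub> y \<odot>\<^sub>r\<^bsub>M\<^esub> s"
    and rsmult_r_distr:
      "\<lbrakk>x \<in> carrier M; s \<in> carrier S; s' \<in> carrier S\<rbrakk> \<Longrightarrow>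
       x \<odot>\<^sub>r\<^bsub>M\<^esub> (s \<oplus>\<^bsub>S\<^esub> s') = x \<odot>\<^sub>r\<^bsub>M\<^esub> s \<oplus>\<^bsub>M\<^esub> x \<odot>\<^sub>r\<^bsub>M\<^esub> s'"
    and rsmult_assoc:
      "\<lbrakk>x \<in> carrier M; s \<in> carrier S; s' \<in> carrier S\<rbrakk> \<Longrightarrow>
       x \<odot>\<^sub>r\<^bsub>M\<^esub> (s \<otimes>\<^bsub>S\<^esub> s') = (x \<odot>\<^sub>r\<^bsub>M\<^esub> s) \<odot>\<^sub>r\<^bsub>M\<^esub> s'"
    and rsmult_one [simp]:
      "x \<in> carrier M \<Longrightarrow> x \<odot>\<^sub>r\<^bsub>M\<^esub> \<one>\<^bsub>S\<^esub> = x"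
    and smult_assoc:
      "\<lbrakk>r \<in> carrier R; x \<in> carrier M; s \<in> carrier S\<rbrakk> \<Longrightarrow>
       (r \<odot>\<^bsub>M\<^esub> x) \<odot>\<^sub>r\<^bsub>M\<^esub> s = r \<odot>\<^bsub>M\<^esub> (x \<odot>\<^sub>r\<^bsub>M\<^esub> s)"

text \<open>The triple \<open>(a, m, b)\<close> encodes the upper triangular matrix with diagonal entries
  \<open>a\<close>, \<open>b\<close> and upper right entry \<open>m\<close>.\<close>

definition triangular_ring ::
    "('r, 'x) ring_scheme \<Rightarrow> ('r, 's, 'm, 'z) bimodule_scheme \<Rightarrow> ('s, 'y) ring_scheme \<Rightarrow>
     ('r \<times> 'm \<times> 's) ring"
  where "triangular_ring R M S =
    \<lparr>carrier = carrier R \<times> carrier M \<times> carrier S,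
     monoid.mult = \<lambda>(a, m, b) (a', m', b').
       (a \<otimes>\<^bsub>R\<^esub> a', (a \<odot>\<^bsub>M\<^esub> m') \<oplus>\<^bsub>M\<^esub> (m \<odot>\<^sub>r\<^bsub>M\<^esub> b'), b \<otimes>\<^bsub>S\<^esub> b'),
     monoid.one = (\<one>\<^bsub>R\<^esub>, \<zero>\<^bsub>M\<^esub>, \<one>\<^bsub>S\<^esub>),
     ring.zero = (\<zero>\<^bsub>R\<^esub>, \<zero>\<^bsub>M\<^esub>, \<zero>\<^bsub>S\<^esub>),
     ring.add = \<lambda>(a, m, b) (a', m', b'). (a \<oplus>\<^bsub>R\<^esub> a', m \<oplus>\<^bsub>M\<^esub> m', b \<oplus>\<^bsub>S\<^esub> b')\<rparr>"

definition regular_element :: "('a, 'x) ring_scheme \<Rightarrow> 'a \<Rightarrow> bool"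
  where "regular_element R a \<longleftrightarrow>
    a \<in> carrier R \<and> (\<exists>b\<in>carrier R. a = a \<otimes>\<^bsub>R\<^esub> b \<otimes>\<^bsub>R\<^esub> a)"

definition idempotent_element :: "('a, 'x) ring_scheme \<Rightarrow> 'a \<Rightarrow> bool"
  where "idempotent_element R e \<longleftrightarrow> e \<in> carrier R \<and> e \<otimes>\<^bsub>R\<^esub> e = e"

context bimodule
begin

lemma lsmult_zero [simp]: "r \<in> carrier R \<Longrightarrow> r \<odot>\<^bsub>M\<^esub> \<zero>\<^bsub>M\<^esub> = \<zero>\<^bsub>M\<^esub>"
  using lsmult_r_distr[of r "\<zero>\<^bsub>M\<^esub>" "\<zero>\<^bsub>M\<^esub>"] by (simp add: M.add.l_cancel_one)

lemma rsmult_zero [simp]: "s \<in> carrier S \<Longrightarrow> \<zero>\<^bsub>M\<^esub> \<odot>\<^sub>r\<^bsub>M\<^esub> s = \<zero>\<^bsub>M\<^esub>"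
  using rsmult_l_distr[of "\<zero>\<^bsub>M\<^esub>" "\<zero>\<^bsub>M\<^esub>" s] by (simp add: M.add.l_cancel_one)

lemma ring_triangular_ring: "ring (triangular_ring R M S)"
proof (rule ringI)
  show "abelian_group (triangular_ring R M S)"
  proof (rule abelian_groupI)
    fix x assume "x \<in> carrier (triangular_ring R M S)"
    then obtain a m b where x: "x = (a, m, b)"
      and abm: "a \<in> carrier R" "m \<in> carrier M" "b \<in> carrier S"
      by (auto simp: triangular_ring_def)
    show "\<exists>y\<in>carrier (triangular_ring R M S).
        y \<oplus>\<^bsub>triangular_ring R M S\<^esub> x = \<zero>\<^bsub>triangular_ring R M S\<^esub>"
      using abm
      by (intro bexI[of _ "(\<ominus>\<^bsub>R\<^esub> a, \<ominus>\<^bsub>M\<^esub> m, \<ominus>\<^bsub>S\<^esub> b)"])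
         (auto simp: triangular_ring_def x R.l_neg S.l_neg M.l_neg)
  qed (auto simp: triangular_ring_def R.a_ac S.a_ac M.a_ac)
next
  show "Group.monoid (triangular_ring R M S)"
    by (rule monoidI)
       (auto simp: triangular_ring_def R.m_assoc S.m_assoc lsmult_assoc rsmult_assoc
         smult_assoc lsmult_r_distr rsmult_l_distr M.a_assoc)
qed (auto simp: triangular_ring_def R.l_distr S.l_distr R.r_distr S.r_distr
      lsmult_l_distr lsmult_r_distr rsmult_l_distr rsmult_r_distr M.a_ac)

end

end

theory Submission
  imports Defs
begin

text \<open>A quasi-inverse \<open>(x, n, y)\<close> of \<open>(a, m, b)\<close> gives the idempotents \<open>e = ax\<close> and \<open>f = yb\<close>.
  The vanishing of \<open>(1 - e)m(1 - f)\<close> says \<open>m + emf = em + mf\<close>, and the upper right entry of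
  \<open>(a, m, b)(x, n, y)(a, m, b) = (a, m, b)\<close> says \<open>m = em + anb + mf\<close>; conversely,
  \<open>n = -xmy\<close> satisfies \<open>anb = -emf\<close>.\<close>

context ring
begin

text \<open>Cosets of the multiplicative monoid: \<open>a <# carrier R\<close> is the principal
  right ideal aR. Two such ideals agree when each contains the generator of the other. As e is
  idempotent, a = er forces ea = e(er) = a, so membership of a in eR becomes an equation. Together
  with e = ax this yields axa = a, the form in which regularity uses it.\<close>

lemma l_coset_eq_idempotent_iff:
  assumes "idempotent_element R e" and "a \<in> carrier R"
  shows "a <# carrier R = e <# carrier R \<longleftrightarrow> e \<otimes> a = a \<and> (\<exists>x\<in>carrier R. e = a \<otimes> x)"
proof
  have e: "e \<in> carrier R" "e \<otimes> e = e"
    using assms(1) by (auto simp: idempotent_element_def)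
  {
    assume eq: "a <# carrier R = e <# carrier R"
    have "a \<in> a <# carrier R" "e \<in> e <# carrier R"
      using assms(2) e by (force simp: l_coset_def intro: bexI[of _ \<one>])+
    then have "a \<in> e <# carrier R" "e \<in> a <# carrier R"
      using eq by simp_all
    then obtain r x where "r \<in> carrier R" "a = e \<otimes> r" "x \<in> carrier R" "e = a \<otimes> x"
      by (auto simp: l_coset_def)
    then show "e \<otimes> a = a \<and> (\<exists>x\<in>carrier R. e = a \<otimes> x)"
      using e by (metis m_assoc)
  next
    assume "e \<otimes> a = a \<and> (\<exists>x\<in>carrier R. e = a \<otimes> x)"
    then obtain x where x: "e \<otimes> a = a" "x \<in> carrier R" "e = a \<otimes> x"
      by blast
    \<comment> \<open>One equation for each inclusion: ar lies in eR, and er = (ax)r lies in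
      aR.\<close>
    have "a \<otimes> r = e \<otimes> (a \<otimes> r)" "e \<otimes> r = a \<otimes> (x \<otimes> r)" if "r \<in> carrier R" for r
      using that x assms(2) e by (metis m_assoc)+
    then show "a <# carrier R = e <# carrier R"
      using x assms(2) unfolding l_coset_def by blast
  }
qed

text \<open>Mirror image for principal left ideals: the idempotent f now fixes b from the right, and
  y multiplies b from the left.\<close>

lemma r_coset_eq_idempotent_iff:
  assumes "idempotent_element R f" and "b \<in> carrier R"
  shows "carrier R #> b = carrier R #> f \<longleftrightarrow> b \<otimes> f = b \<and> (\<exists>y\<in>carrier R. f = y \<otimes> b)"
proof
  have f: "f \<in> carrier R" "f \<otimes> f = f"
    using assms(1) by (auto simp: idempotent_element_def)
  {
    assume eq: "carrier R #> b = carrier R #> f"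
    have "b \<in> carrier R #> b" "f \<in> carrier R #> f"
      using assms(2) f by (force simp: r_coset_def intro: bexI[of _ \<one>])+
    then have "b \<in> carrier R #> f" "f \<in> carrier R #> b"
      using eq by simp_all
    then obtain r y where "r \<in> carrier R" "b = r \<otimes> f" "y \<in> carrier R" "f = y \<otimes> b"
      by (auto simp: r_coset_def)
    then show "b \<otimes> f = b \<and> (\<exists>y\<in>carrier R. f = y \<otimes> b)"
      using f by (metis m_assoc)
  next
    assume "b \<otimes> f = b \<and> (\<exists>y\<in>carrier R. f = y \<otimes> b)"
    then obtain y where y: "b \<otimes> f = b" "y \<in> carrier R" "f = y \<otimes> b"
      by blast
    have "r \<otimes> b = (r \<otimes> b) \<otimes> f" "r \<otimes> f = (r \<otimes> y) \<otimes> b" if "r \<in> carrier R" for r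
      using that y assms(2) f by (metis m_assoc)+
    then show "carrier R #> b = carrier R #> f"
      using y assms(2) unfolding r_coset_def by blast
  }
qed

end

context bimodule
begin

lemma lsmult_uminus:
  assumes "r \<in> carrier R" and "x \<in> carrier M"
  shows "r \<odot>\<^bsub>M\<^esub> (\<ominus>\<^bsub>M\<^esub> x) = \<ominus>\<^bsub>M\<^esub> (r \<odot>\<^bsub>M\<^esub> x)"
  using assms lsmult_r_distr[of r "\<ominus>\<^bsub>M\<^esub> x" x]
  by (intro M.minus_equality[symmetric]) (auto simp: M.l_neg)

lemma rsmult_uminus:
  assumes "x \<in> carrier M" and "s \<in> carrier S"
  shows "(\<ominus>\<^bsub>M\<^esub> x) \<odot>\<^sub>r\<^bsub>M\<^esub> s = \<ominus>\<^bsub>M\<^esub> (x \<odot>\<^sub>r\<^bsub>M\<^esub> s)"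
  using assms rsmult_l_distr[of "\<ominus>\<^bsub>M\<^esub> x" x s]
  by (intro M.minus_equality[symmetric]) (auto simp: M.l_neg)

text \<open>Formally (1 - e)m(1 - f) = m - em - mf + emf. Moving the negative terms across leaves an
  identity of sums, which can be compared directly with the upper right entry of a matrix
  product.\<close>

lemma complement_smult_eq_zero_iff:
  assumes e: "e \<in> carrier R" and m: "m \<in> carrier M" and f: "f \<in> carrier S"
  shows "((\<one>\<^bsub>R\<^esub> \<ominus>\<^bsub>R\<^esub> e) \<odot>\<^bsub>M\<^esub> m) \<odot>\<^sub>r\<^bsub>M\<^esub> (\<one>\<^bsub>S\<^esub> \<ominus>\<^bsub>S\<^esub> f) = \<zero>\<^bsub>M\<^esub> \<longleftrightarrow>
    m \<oplus>\<^bsub>M\<^esub> (e \<odot>\<^bsub>M\<^esub> m) \<odot>\<^sub>r\<^bsub>M\<^esub> f = e \<odot>\<^bsub>M\<^esub> m \<oplus>\<^bsub>M\<^esub> m \<odot>\<^sub>r\<^bsub>M\<^esub> f"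
proof -
  \<comment> \<open>The element m is split in two stages: m = u + v by 1 = (1 - e) + e on the left,
    then u = w + uf by 1 = (1 - f) + f on the right.\<close>
  define u where "u = (\<one>\<^bsub>R\<^esub> \<ominus>\<^bsub>R\<^esub> e) \<odot>\<^bsub>M\<^esub> m"
  define v where "v = e \<odot>\<^bsub>M\<^esub> m"
  define w where "w = u \<odot>\<^sub>r\<^bsub>M\<^esub> (\<one>\<^bsub>S\<^esub> \<ominus>\<^bsub>S\<^esub> f)"
  have uv: "u \<in> carrier M" "v \<in> carrier M" and w: "w \<in> carrier M"
    using e m f by (auto simp: u_def v_def w_def)
  have "\<one>\<^bsub>R\<^esub> \<ominus>\<^bsub>R\<^esub> e \<oplus>\<^bsub>R\<^esub> e = \<one>\<^bsub>R\<^esub>"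
    using e by (simp add: R.minus_eq R.a_assoc R.l_neg)
  then have m_eq: "m = u \<oplus>\<^bsub>M\<^esub> v"
    using lsmult_l_distr[of "\<one>\<^bsub>R\<^esub> \<ominus>\<^bsub>R\<^esub> e" e m] e m by (simp add: u_def v_def)
  have "\<one>\<^bsub>S\<^esub> \<ominus>\<^bsub>S\<^esub> f \<oplus>\<^bsub>S\<^esub> f = \<one>\<^bsub>S\<^esub>"
    using f by (simp add: S.minus_eq S.a_assoc S.l_neg)
  then have u_eq: "u = w \<oplus>\<^bsub>M\<^esub> u \<odot>\<^sub>r\<^bsub>M\<^esub> f"
    using rsmult_r_distr[of u "\<one>\<^bsub>S\<^esub> \<ominus>\<^bsub>S\<^esub> f" f] f uv by (simp add: w_def)
  have uf: "u \<odot>\<^sub>r\<^bsub>M\<^esub> f \<in> carrier M" "v \<odot>\<^sub>r\<^bsub>M\<^esub> f \<in> carrier M"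
    using uv f by auto
  \<comment> \<open>The two sides of the claim differ exactly by w: both contain uf + v + vf, and
    cancelling it leaves w = 0.\<close>
  have "m \<oplus>\<^bsub>M\<^esub> v \<odot>\<^sub>r\<^bsub>M\<^esub> f = w \<oplus>\<^bsub>M\<^esub> (u \<odot>\<^sub>r\<^bsub>M\<^esub> f \<oplus>\<^bsub>M\<^esub> v \<oplus>\<^bsub>M\<^esub> v \<odot>\<^sub>r\<^bsub>M\<^esub> f)"
    using m_eq u_eq uv uf w by (metis M.a_assoc M.add.m_closed)
  moreover have "v \<oplus>\<^bsub>M\<^esub> m \<odot>\<^sub>r\<^bsub>M\<^esub> f = u \<odot>\<^sub>r\<^bsub>M\<^esub> f \<oplus>\<^bsub>M\<^esub> v \<oplus>\<^bsub>M\<^esub> v \<odot>\<^sub>r\<^bsub>M\<^esub> f"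
    using uv uf f by (simp add: m_eq rsmult_l_distr M.a_ac)
  ultimately have "w = \<zero>\<^bsub>M\<^esub> \<longleftrightarrow> m \<oplus>\<^bsub>M\<^esub> v \<odot>\<^sub>r\<^bsub>M\<^esub> f = v \<oplus>\<^bsub>M\<^esub> m \<odot>\<^sub>r\<^bsub>M\<^esub> f"
    using w uv uf by simp
  then show ?thesis
    by (simp add: u_def v_def w_def)
qed

text \<open>The equation is read off entry by entry. The upper right entry of the triple product is
  (ax)m + (an + my)b; it is expanded and reassociated so that the products ax and yb, the future
  idempotents, appear as scalars.\<close>

lemma regular_element_triangular_ring_iff:
  assumes "a \<in> carrier R" and "m \<in> carrier M" and "b \<in> carrier S"
  shows "regular_element (triangular_ring R M S) (a, m, b) \<longleftrightarrow>
    (\<exists>x\<in>carrier R. \<exists>n\<in>carrier M. \<exists>y\<in>carrier S.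
       a = a \<otimes>\<^bsub>R\<^esub> x \<otimes>\<^bsub>R\<^esub> a \<and> b = b \<otimes>\<^bsub>S\<^esub> y \<otimes>\<^bsub>S\<^esub> b \<and>
       m = (a \<otimes>\<^bsub>R\<^esub> x) \<odot>\<^bsub>M\<^esub> m \<oplus>\<^bsub>M\<^esub>
         ((a \<odot>\<^bsub>M\<^esub> n) \<odot>\<^sub>r\<^bsub>M\<^esub> b \<oplus>\<^bsub>M\<^esub> m \<odot>\<^sub>r\<^bsub>M\<^esub> (y \<otimes>\<^bsub>S\<^esub> b)))"
  using assms
  by (fastforce simp: regular_element_def triangular_ring_def rsmult_l_distr rsmult_assoc)

lemma regular_element_triangular_ring_iff_idempotents:
  assumes a: "a \<in> carrier R" and m: "m \<in> carrier M" and b: "b \<in> carrier S"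
  shows "regular_element (triangular_ring R M S) (a, m, b) \<longleftrightarrow>
    (\<exists>e f. idempotent_element R e \<and> idempotent_element S f \<and>
       a <#\<^bsub>R\<^esub> carrier R = e <#\<^bsub>R\<^esub> carrier R \<and>
       carrier S #>\<^bsub>S\<^esub> b = carrier S #>\<^bsub>S\<^esub> f \<and>
       ((\<one>\<^bsub>R\<^esub> \<ominus>\<^bsub>R\<^esub> e) \<odot>\<^bsub>M\<^esub> m) \<odot>\<^sub>r\<^bsub>M\<^esub> (\<one>\<^bsub>S\<^esub> \<ominus>\<^bsub>S\<^esub> f) = \<zero>\<^bsub>M\<^esub>)"
    (is "_ \<longleftrightarrow> (\<exists>e f. ?P e f)")
proof
  assume "regular_element (triangular_ring R M S) (a, m, b)"
  then obtain x n y where xny: "x \<in> carrier R" "n \<in> carrier M" "y \<in> carrier S"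
    and axa: "a \<otimes>\<^bsub>R\<^esub> x \<otimes>\<^bsub>R\<^esub> a = a" and byb: "b \<otimes>\<^bsub>S\<^esub> y \<otimes>\<^bsub>S\<^esub> b = b"
    and m_eq: "m = (a \<otimes>\<^bsub>R\<^esub> x) \<odot>\<^bsub>M\<^esub> m \<oplus>\<^bsub>M\<^esub>
      ((a \<odot>\<^bsub>M\<^esub> n) \<odot>\<^sub>r\<^bsub>M\<^esub> b \<oplus>\<^bsub>M\<^esub> m \<odot>\<^sub>r\<^bsub>M\<^esub> (y \<otimes>\<^bsub>S\<^esub> b))"
    unfolding regular_element_triangular_ring_iff[OF assms] by metis
  define e where "e = a \<otimes>\<^bsub>R\<^esub> x"
  define f where "f = y \<otimes>\<^bsub>S\<^esub> b"
  define k where "k = (a \<odot>\<^bsub>M\<^esub> n) \<odot>\<^sub>r\<^bsub>M\<^esub> b"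
  have e: "e \<in> carrier R" and f: "f \<in> carrier S" and k: "k \<in> carrier M"
    using a b xny by (auto simp: e_def f_def k_def)
  have ea: "e \<otimes>\<^bsub>R\<^esub> a = a" and bf: "b \<otimes>\<^bsub>S\<^esub> f = b"
    using axa byb b xny by (auto simp: e_def f_def S.m_assoc)
  \<comment> \<open>From ea = a: ee = e(ax) = (ea)x = ax = e.\<close>
  have "e \<otimes>\<^bsub>R\<^esub> e = e"
    using ea R.m_assoc[of e a x] a e xny by (simp add: e_def)
  then have idem_e: "idempotent_element R e"
    using e by (simp add: idempotent_element_def)
  have ff: "f \<otimes>\<^bsub>S\<^esub> f = f"
    using bf S.m_assoc[of y b f] b f xny by (simp add: f_def)
  then have idem_f: "idempotent_element S f"
    using f by (simp add: idempotent_element_def)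
  \<comment> \<open>The middle term k = anb ends in b, so it inherits bf = b.\<close>
  have kf: "k \<odot>\<^sub>r\<^bsub>M\<^esub> f = k"
    using bf rsmult_assoc[of "a \<odot>\<^bsub>M\<^esub> n" b f] a b f xny by (simp add: k_def)
  define p where "p = e \<odot>\<^bsub>M\<^esub> m"
  define q where "q = m \<odot>\<^sub>r\<^bsub>M\<^esub> f"
  have pq: "p \<in> carrier M" "q \<in> carrier M"
    using e f m by (auto simp: p_def q_def)
  have m_eq': "m = p \<oplus>\<^bsub>M\<^esub> (k \<oplus>\<^bsub>M\<^esub> q)"
    using m_eq by (simp add: e_def f_def k_def p_def q_def)
  have "q \<odot>\<^sub>r\<^bsub>M\<^esub> f = q"
    using rsmult_assoc[of m f f] ff m f by (simp add: q_def)
  \<comment> \<open>Multiplying m = p + (k + q) by f on the right fixes k and q and turns m into q.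
    The summand k + q is deliberately not cancelled: adding p below rebuilds m from p + (k + q) and
    leaves m + pf = p + q.\<close>
  then have "q = p \<odot>\<^sub>r\<^bsub>M\<^esub> f \<oplus>\<^bsub>M\<^esub> (k \<oplus>\<^bsub>M\<^esub> q)"
    using arg_cong[OF m_eq', of "\<lambda>z. z \<odot>\<^sub>r\<^bsub>M\<^esub> f"] pq k f kf
    by (simp add: rsmult_l_distr flip: q_def)
  then have "p \<oplus>\<^bsub>M\<^esub> q = p \<oplus>\<^bsub>M\<^esub> (p \<odot>\<^sub>r\<^bsub>M\<^esub> f \<oplus>\<^bsub>M\<^esub> (k \<oplus>\<^bsub>M\<^esub> q))"
    by simp
  also have "\<dots> = p \<oplus>\<^bsub>M\<^esub> (k \<oplus>\<^bsub>M\<^esub> q) \<oplus>\<^bsub>M\<^esub> p \<odot>\<^sub>r\<^bsub>M\<^esub> f"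
    using pq k f by (simp add: M.a_ac)
  finally have "m \<oplus>\<^bsub>M\<^esub> p \<odot>\<^sub>r\<^bsub>M\<^esub> f = p \<oplus>\<^bsub>M\<^esub> q"
    by (simp flip: m_eq')
  then have "((\<one>\<^bsub>R\<^esub> \<ominus>\<^bsub>R\<^esub> e) \<odot>\<^bsub>M\<^esub> m) \<odot>\<^sub>r\<^bsub>M\<^esub> (\<one>\<^bsub>S\<^esub> \<ominus>\<^bsub>S\<^esub> f) = \<zero>\<^bsub>M\<^esub>"
    by (simp add: complement_smult_eq_zero_iff[OF e m f] p_def q_def)
  moreover have "a <#\<^bsub>R\<^esub> carrier R = e <#\<^bsub>R\<^esub> carrier R"
    unfolding R.l_coset_eq_idempotent_iff[OF idem_e a] using ea xny e_def by blast
  moreover have "carrier S #>\<^bsub>S\<^esub> b = carrier S #>\<^bsub>S\<^esub> f"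
    unfolding S.r_coset_eq_idempotent_iff[OF idem_f b] using bf xny f_def by blast
  ultimately show "\<exists>e f. ?P e f"
    using idem_e idem_f by blast
next
  assume "\<exists>e f. ?P e f"
  then obtain e f where idem: "idempotent_element R e" "idempotent_element S f"
    and aR: "a <#\<^bsub>R\<^esub> carrier R = e <#\<^bsub>R\<^esub> carrier R"
    and Sb: "carrier S #>\<^bsub>S\<^esub> b = carrier S #>\<^bsub>S\<^esub> f"
    and zero: "((\<one>\<^bsub>R\<^esub> \<ominus>\<^bsub>R\<^esub> e) \<odot>\<^bsub>M\<^esub> m) \<odot>\<^sub>r\<^bsub>M\<^esub> (\<one>\<^bsub>S\<^esub> \<ominus>\<^bsub>S\<^esub> f) = \<zero>\<^bsub>M\<^esub>"
    by blast
  have e: "e \<in> carrier R" and f: "f \<in> carrier S"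
    using idem by (auto simp: idempotent_element_def)
  \<comment> \<open>With e = ax, the equation ea = a already says axa = a; in the same way y will be
    a quasi-inverse of b. Only the upper right entry then remains to be arranged, by the choice of
    \<open>n\<close>.\<close>
  obtain x where x: "x \<in> carrier R" "e \<otimes>\<^bsub>R\<^esub> a = a" "e = a \<otimes>\<^bsub>R\<^esub> x"
    using aR R.l_coset_eq_idempotent_iff[OF idem(1) a] by blast
  obtain y where y: "y \<in> carrier S" "b \<otimes>\<^bsub>S\<^esub> f = b" "f = y \<otimes>\<^bsub>S\<^esub> b"
    using Sb S.r_coset_eq_idempotent_iff[OF idem(2) b] by blast
  define n where "n = \<ominus>\<^bsub>M\<^esub> (x \<odot>\<^bsub>M\<^esub> (m \<odot>\<^sub>r\<^bsub>M\<^esub> y))"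
  define g where "g = (e \<odot>\<^bsub>M\<^esub> m) \<odot>\<^sub>r\<^bsub>M\<^esub> f"
  have n: "n \<in> carrier M" and g: "g \<in> carrier M"
    using x y m e f by (auto simp: n_def g_def)
  have emf: "e \<odot>\<^bsub>M\<^esub> m \<in> carrier M" "m \<odot>\<^sub>r\<^bsub>M\<^esub> f \<in> carrier M"
    using e m f by auto
  have anb: "(a \<odot>\<^bsub>M\<^esub> n) \<odot>\<^sub>r\<^bsub>M\<^esub> b = \<ominus>\<^bsub>M\<^esub> g"
    using a b m x(1) y(1)
    by (simp add: n_def g_def x(3) y(3) lsmult_uminus rsmult_uminus lsmult_assoc rsmult_assoc
        smult_assoc)
  have "m \<oplus>\<^bsub>M\<^esub> g = e \<odot>\<^bsub>M\<^esub> m \<oplus>\<^bsub>M\<^esub> m \<odot>\<^sub>r\<^bsub>M\<^esub> f"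
    using zero complement_smult_eq_zero_iff[OF e m f] by (simp add: g_def)
  \<comment> \<open>Solving the vanishing condition for m produces the correction term -g, which is
    anb by \<open>anb\<close>; this is the required upper right entry.\<close>
  then have "m = e \<odot>\<^bsub>M\<^esub> m \<oplus>\<^bsub>M\<^esub> m \<odot>\<^sub>r\<^bsub>M\<^esub> f \<oplus>\<^bsub>M\<^esub> \<ominus>\<^bsub>M\<^esub> g"
    using m g M.a_assoc[of m g "\<ominus>\<^bsub>M\<^esub> g"] by (simp add: M.r_neg)
  also have "\<dots> = e \<odot>\<^bsub>M\<^esub> m \<oplus>\<^bsub>M\<^esub> ((a \<odot>\<^bsub>M\<^esub> n) \<odot>\<^sub>r\<^bsub>M\<^esub> b \<oplus>\<^bsub>M\<^esub> m \<odot>\<^sub>r\<^bsub>M\<^esub> f)"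
    using emf g by (simp add: anb M.a_ac)
  finally have "m = (a \<otimes>\<^bsub>R\<^esub> x) \<odot>\<^bsub>M\<^esub> m \<oplus>\<^bsub>M\<^esub>
      ((a \<odot>\<^bsub>M\<^esub> n) \<odot>\<^sub>r\<^bsub>M\<^esub> b \<oplus>\<^bsub>M\<^esub> m \<odot>\<^sub>r\<^bsub>M\<^esub> (y \<otimes>\<^bsub>S\<^esub> b))"
    unfolding x(3) y(3) .
  moreover have "a = a \<otimes>\<^bsub>R\<^esub> x \<otimes>\<^bsub>R\<^esub> a"
    using x by simp
  moreover have "b = b \<otimes>\<^bsub>S\<^esub> y \<otimes>\<^bsub>S\<^esub> b"
    using y b by (simp add: S.m_assoc)
  ultimately show "regular_element (triangular_ring R M S) (a, m, b)"
    unfolding regular_element_triangular_ring_iff[OF assms] using x(1) y(1) n by blast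
qed

end

theorem proposition2p8:
  fixes R :: "('r, 'x) ring_scheme"
    and S :: "('s, 'y) ring_scheme"
    and M :: "('r, 's, 'm, 'z) bimodule_scheme"
  assumes "bimodule R S M"
    and "a \<in> carrier R" and "m \<in> carrier M" and "b \<in> carrier S"
  shows "regular_element (triangular_ring R M S) (a, m, b) \<longleftrightarrow>
    (\<exists>e f. idempotent_element R e \<and> idempotent_element S f \<and>
       a <#\<^bsub>R\<^esub> carrier R = e <#\<^bsub>R\<^esub> carrier R \<and>
       carrier S #>\<^bsub>S\<^esub> b = carrier S #>\<^bsub>S\<^esub> f \<and>
       ((\<one>\<^bsub>R\<^esub> \<ominus>\<^bsub>R\<^esub> e) \<odot>\<^bsub>M\<^esub> m) \<odot>\<^sub>r\<^bsub>M\<^esub> (\<one>\<^bsub>S\<^esub> \<ominus>\<^bsub>S\<^esub> f) = \<zero>\<^bsub>M\<^esub>)"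
  using bimodule.regular_element_triangular_ring_iff_idempotents[OF assms] .

end
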